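(* The following three identities hold: \[ \sum_{n=0}^{\infty}\frac{(-1)^n}{(2n+1)^3}=\frac{\pi^3}{32}, \] \[ \frac{1}{1^3}+\frac{0}{3^3}-\frac{1}{5^3}+\frac{1}{7^3}+\frac{0}{9^3}-\frac{1}{11^3}+\cdots=\sum_{k=0}^{\infty}\left(\frac{1}{(6k+1)^3}-\frac{1}{(6k+5)^3}\right)=\frac{\pi^3}{18\sqrt{3}}, \] \[ 1+\frac{1}{3^3}-\frac{1}{5^3}-\frac{1}{7^3}+\frac{1}{9^3}+\frac{1}{11^3}-\cdots=\sum_{k=0}^{\infty}\left(\frac{1}{(8k+1)^3}+\frac{1}{(8k+3)^3}-\frac{1}{(8k+5)^3}-\frac{1}{(8k+7)^3}\right)=\frac{3\pi^3}{64\sqrt{2}}. \]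
   Context: In the second series the coefficient of $1/n^3$ for odd $n$ is periodic in $n$ with period $6$: it is $1,0,-1$ for $n\equiv 1,3,5 \pmod 6$. In the third series the coefficient of $1/n^3$ for odd $n$ is periodic with period $8$: it is $1,1,-1,-1$ for $n\equiv 1,3,5,7\pmod 8$. *)

theory Defs
  imports Complex_Main
begin

(* Numerators of the second and third series; they are used at odd n only,
   the value 0 at even n is a convention. *)

definition coeff6 :: "nat \<Rightarrow> real" where
  "coeff6 n = (if n mod 6 = 1 then 1 else if n mod 6 = 5 then -1 else 0)"

definition coeff8 :: "nat \<Rightarrow> real" where
  "coeff8 n = (if n mod 8 \<in> {1, 3} then 1 else if n mod 8 \<in> {5, 7} then -1 else 0)"

end

theory Submission
  imports Defs "HOL-Analysis.Gamma_Function"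
begin

text \<open>
  All three series are values of one function. For \<open>0 < x < 1\<close>,
  \<open>\<Sum>k. (1 / (k + x)^3 - 1 / (k + 1 - x)^3) = \<pi>^3 cos (\<pi> x) / sin (\<pi> x)^3\<close>,
  which is \<open>sums_cubes_reflection\<close>. The left side is the difference of \<open>- \<psi>'' / 2\<close> at \<open>x\<close>
  and at \<open>1 - x\<close>, where \<open>\<psi>\<close> is the digamma function. Its closed form comes from Euler's
  reflection formula \<open>\<Gamma>(x) \<Gamma>(1 - x) = \<pi> / sin (\<pi> x)\<close> by taking logarithms and differentiating
  three times.

  Scaling the formula by \<open>1 / q^3\<close> at \<open>x = a / q\<close> pairs the residue classes \<open>a\<close> and \<open>q - a\<close>
  modulo \<open>q\<close> with opposite signs, which is what the odd periodic numerators do. The values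
  needed are \<open>x = 1/4\<close>, \<open>x = 1/6\<close>, and the sum of those at \<open>x = 1/8\<close> and \<open>x = 3/8\<close>. This
  evaluates the series after grouping each period into one term; absolute convergence then
  gives the ungrouped series (lemma \<open>odd_cubes_sums_from_blocks\<close>).
\<close>

section \<open>The cubic reflection formula\<close>

lemma DERIV_unique_on_open:
  fixes f g :: "real \<Rightarrow> real"
  assumes "(f has_real_derivative D) (at x)" "(g has_real_derivative E) (at x)"
    and "open S" "x \<in> S" "\<And>y. y \<in> S \<Longrightarrow> f y = g y"
  shows "D = E"
  using has_field_derivative_transform_within_open[OF assms(1,3,4,5)] assms(2)
  by (rule DERIV_unique)

lemma Gamma_reflection_real:
  fixes x :: real
  shows "Gamma x * Gamma (1 - x) = pi / sin (pi * x)"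
proof -
  have "complex_of_real (Gamma x * Gamma (1 - x)) = Gamma (of_real x) * Gamma (1 - of_real x)"
    by (simp flip: Gamma_complex_of_real)
  also have "\<dots> = of_real pi / sin (of_real pi * of_real x)"
    by (rule Gamma_reflection_complex)
  also have "\<dots> = complex_of_real (pi / sin (pi * x))"
    by (simp add: sin_of_real flip: of_real_mult)
  finally show ?thesis
    by (simp only: of_real_eq_iff)
qed

lemma sin_pi_times_pos: "0 < x \<Longrightarrow> x < 1 \<Longrightarrow> sin (pi * x) > 0" for x :: real
  by (rule sin_gt_zero) auto

lemma ln_Gamma_reflection:
  fixes x :: real
  assumes "0 < x" "x < 1"
  shows "ln_Gamma x + ln_Gamma (1 - x) = ln pi - ln (sin (pi * x))"
proof -
  have "ln_Gamma x + ln_Gamma (1 - x) = ln (Gamma x * Gamma (1 - x))"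
    using assms by (simp add: ln_Gamma_real_pos ln_mult_pos)
  also have "\<dots> = ln pi - ln (sin (pi * x))"
    using sin_pi_times_pos[OF assms] by (simp add: Gamma_reflection_real ln_div)
  finally show ?thesis .
qed

lemma not_nonpos_Ints: "x \<notin> \<int>\<^sub>\<le>\<^sub>0" if "x > 0" for x :: real
  using that by (auto elim!: nonpos_Ints_cases)

lemma Digamma_reflection:
  fixes x :: real
  assumes x: "0 < x" "x < 1"
  shows "Digamma x - Digamma (1 - x) = - pi * cos (pi * x) / sin (pi * x)"
proof (rule DERIV_unique_on_open)
  show "((\<lambda>x. ln_Gamma x + ln_Gamma (1 - x)) has_real_derivative Digamma x - Digamma (1 - x)) (at x)"
    using x by (auto intro!: derivative_eq_intros)
  show "((\<lambda>x. ln pi - ln (sin (pi * x))) has_real_derivative - pi * cos (pi * x) / sin (pi * x)) (at x)"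
    using sin_pi_times_pos[OF x] by (auto intro!: derivative_eq_intros simp: field_simps)
qed (use x ln_Gamma_reflection in \<open>auto intro: open_greaterThanLessThan[of 0 1]\<close>)

lemma Trigamma_reflection:
  fixes x :: real
  assumes x: "0 < x" "x < 1"
  shows "Polygamma 1 x + Polygamma 1 (1 - x) = pi ^ 2 / sin (pi * x) ^ 2"
proof (rule DERIV_unique_on_open)
  show "((\<lambda>x. Digamma x - Digamma (1 - x)) has_real_derivative Polygamma 1 x + Polygamma 1 (1 - x)) (at x)"
    using x by (auto intro!: derivative_eq_intros simp: not_nonpos_Ints)
  \<comment> \<open>The right-hand side is the derivative in the shape that the quotient rule produces.\<close>
  have pythagoras: "pi ^ 2 / sin (pi * x) ^ 2
      = (pi ^ 2 * sin (pi * x) ^ 2 + pi ^ 2 * cos (pi * x) ^ 2) / sin (pi * x) ^ 2"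
    unfolding distrib_left[symmetric] by simp
  show "((\<lambda>x. - pi * cos (pi * x) / sin (pi * x)) has_real_derivative pi ^ 2 / sin (pi * x) ^ 2) (at x)"
    unfolding pythagoras using sin_pi_times_pos[OF x]
    by (auto intro!: derivative_eq_intros simp: power2_eq_square field_simps)
qed (use x Digamma_reflection in \<open>auto intro: open_greaterThanLessThan[of 0 1]\<close>)

lemma Tetragamma_reflection:
  fixes x :: real
  assumes x: "0 < x" "x < 1"
  shows "Polygamma 2 x - Polygamma 2 (1 - x) = - 2 * pi ^ 3 * cos (pi * x) / sin (pi * x) ^ 3"
proof (rule DERIV_unique_on_open)
  show "((\<lambda>x. Polygamma 1 x + Polygamma 1 (1 - x)) has_real_derivative Polygamma 2 x - Polygamma 2 (1 - x)) (at x)"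
    using x by (auto intro!: derivative_eq_intros simp: not_nonpos_Ints numeral_2_eq_2)
  show "((\<lambda>x. pi ^ 2 / sin (pi * x) ^ 2) has_real_derivative - 2 * pi ^ 3 * cos (pi * x) / sin (pi * x) ^ 3) (at x)"
    using sin_pi_times_pos[OF x]
    by (auto intro!: derivative_eq_intros simp: power2_eq_square power3_eq_cube field_simps)
qed (use x Trigamma_reflection in \<open>auto intro: open_greaterThanLessThan[of 0 1]\<close>)

lemma sums_inverse_cubes_shifted:
  fixes x :: real
  assumes "x > 0"
  shows "(\<lambda>k. 1 / (real k + x) ^ 3) sums (- Polygamma 2 x / 2)"
  using Polygamma_LIMSEQ[of x 2] assms by (simp add: numeral_3_eq_3 add_ac inverse_eq_divide)

theorem sums_cubes_reflection:
  fixes x :: real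
  assumes x: "0 < x" "x < 1"
  shows "(\<lambda>k. 1 / (real k + x) ^ 3 - 1 / (real k + (1 - x)) ^ 3)
           sums (pi ^ 3 * cos (pi * x) / sin (pi * x) ^ 3)"
proof -
  have "(\<lambda>k. 1 / (real k + x) ^ 3 - 1 / (real k + (1 - x)) ^ 3)
          sums (- Polygamma 2 x / 2 - - Polygamma 2 (1 - x) / 2)"
    using x by (intro sums_diff sums_inverse_cubes_shifted) auto
  also have "- Polygamma 2 x / 2 - - Polygamma 2 (1 - x) / 2
      = - (Polygamma 2 x - Polygamma 2 (1 - x)) / 2"
    by (simp add: field_simps)
  also have "\<dots> = pi ^ 3 * cos (pi * x) / sin (pi * x) ^ 3"
    by (simp add: Tetragamma_reflection[OF x])
  finally show ?thesis .
qed

text \<open>The form in which the formula applies to a pair of opposite residue classes modulo \<open>q\<close>.\<close>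

lemma sums_opposite_residues:
  fixes a q :: real
  assumes "0 < a" "a < q"
  shows "(\<lambda>k. 1 / (q * real k + a) ^ 3 - 1 / (q * real k + (q - a)) ^ 3)
           sums (pi ^ 3 / q ^ 3 * (cos (pi * (a / q)) / sin (pi * (a / q)) ^ 3))"
proof -
  have q: "q > 0"
    using assms by simp
  have scale: "1 / (q * real k + b) ^ 3 = 1 / (real k + b / q) ^ 3 / q ^ 3" for k b
  proof -
    have "q * real k + b = (real k + b / q) * q"
      using q by (simp add: field_simps)
    then show ?thesis
      by (simp add: power_mult_distrib)
  qed
  have "(q - a) / q = 1 - a / q"
    using q by (simp add: field_simps)
  then have "1 / (q * real k + a) ^ 3 - 1 / (q * real k + (q - a)) ^ 3
      = (1 / (real k + a / q) ^ 3 - 1 / (real k + (1 - a / q)) ^ 3) / q ^ 3" for k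
    unfolding scale by (simp add: diff_divide_distrib)
  then show ?thesis
    using sums_divide[OF sums_cubes_reflection[of "a / q"], of "q ^ 3"] assms by (simp add: mult.commute)
qed

section \<open>Undoing the grouping by periods\<close>

text \<open>
  Grouping the terms of a convergent series preserves its sum; the converse needs convergence
  of the ungrouped series, which here follows by comparison with \<open>\<Sum>n. 1 / (n + 1) ^ 3\<close>.
\<close>

lemma odd_cubes_sums_from_blocks:
  fixes c :: "nat \<Rightarrow> real"
  assumes c: "\<And>n. \<bar>c n\<bar> \<le> 1" and "m > 0"
    and blocks: "(\<lambda>k. \<Sum>j<m. c (k * m + j) / (2 * real (k * m + j) + 1) ^ 3) sums s"
  shows "(\<lambda>n. c n / (2 * real n + 1) ^ 3) sums s"
proof -
  let ?f = "\<lambda>n. c n / (2 * real n + 1) ^ 3"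
  have "summable (\<lambda>n. 1 / (real n + 1) ^ 3)"
    using sums_inverse_cubes_shifted[of 1] by (auto intro: sums_summable)
  then have f: "summable ?f"
  proof (rule summable_comparison_test')
    fix n :: nat
    have "\<bar>c n\<bar> / (2 * real n + 1) ^ 3 \<le> 1 / (real n + 1) ^ 3"
      by (intro frac_le power_mono) (auto simp: c)
    then show "norm (?f n) \<le> 1 / (real n + 1) ^ 3"
      by simp
  qed
  have "(\<lambda>k. sum ?f {k * m..<k * m + m}) sums suminf ?f"
    using f \<open>m > 0\<close> by (intro sums_group summable_sums)
  then have "(\<lambda>k. \<Sum>j<m. ?f (k * m + j)) sums suminf ?f"
    by (simp add: sum.atLeastLessThan_shift_0[of _ "_ * _"] lessThan_atLeast0)
  then have "s = suminf ?f"
    using blocks by (rule sums_unique2[symmetric])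
  then show ?thesis
    using f by (simp add: summable_sums)
qed

section \<open>The three series\<close>

text \<open>
  With \<open>s = sin (\<pi>/8)\<close> and \<open>c = cos (\<pi>/8)\<close>, the values at \<open>1/8\<close> and \<open>3/8\<close> add up to
  \<open>c/s^3 + s/c^3 = (1 - 2 (s c)^2) / (s c)^3\<close>, and \<open>s c = sin (\<pi>/4) / 2\<close>. Hence no nested
  radicals appear.
\<close>

lemma cos_over_sin_cubed_eighths:
  "cos (pi * (1 / 8)) / sin (pi * (1 / 8)) ^ 3 + cos (pi * (3 / 8)) / sin (pi * (3 / 8)) ^ 3
     = 24 / sqrt (2 :: real)"
proof -
  define s c where "s = sin (pi / 8)" and "c = cos (pi / 8)"
  have "pi * (3 / 8) = pi / 2 - pi / 8"
    by simp
  then have swap: "cos (pi * (3 / 8)) = s" "sin (pi * (3 / 8)) = c"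
    unfolding s_def c_def by (simp_all only: sin_cos_eq[of "pi / 8"] cos_sin_eq[of "pi / 8"] of_real_eq_id id_apply)
  have pos: "s > 0" "c > 0"
    unfolding s_def c_def by (auto intro: sin_gt_zero cos_gt_zero)
  have "sin (2 * (pi / 8)) = 2 * s * c"
    unfolding s_def c_def by (rule sin_double)
  then have sc: "s * c = sqrt 2 / 4"
    by (simp add: sin_45)
  have sc2: "(s * c) ^ 2 = 1 / 8" and sc3: "(s * c) ^ 3 = sqrt 2 / 32"
    unfolding sc by (simp_all add: power_divide power3_eq_cube)
  have "s ^ 4 + c ^ 4 = (s ^ 2 + c ^ 2) ^ 2 - 2 * (s * c) ^ 2"
    by algebra
  also have "s ^ 2 + c ^ 2 = 1"
    by (simp add: s_def c_def)
  finally have four: "s ^ 4 + c ^ 4 = 3 / 4"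
    by (simp add: sc2)
  have "c / s ^ 3 + s / c ^ 3 = (s ^ 4 + c ^ 4) / (s * c) ^ 3"
    using pos by (simp add: field_simps power_mult_distrib eval_nat_numeral)
  also have "\<dots> = 24 / sqrt 2"
    unfolding four sc3 by simp
  finally show ?thesis
    unfolding swap by (simp add: s_def c_def)
qed

lemma quarter_series: "(\<lambda>n. (-1) ^ n / (2 * real n + 1) ^ 3) sums (pi ^ 3 / 32)"
proof -
  have "cos (pi * (1 / 4)) / sin (pi * (1 / 4)) ^ 3 = 2"
    by (simp add: sin_45 cos_45 power3_eq_cube)
  then have grouped: "(\<lambda>k. 1 / (4 * real k + 1) ^ 3 - 1 / (4 * real k + 3) ^ 3) sums (pi ^ 3 / 32)"
    using sums_opposite_residues[of 1 4] by simp
  have "{..<2} = {0, 1 :: nat}"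
    by auto
  then have "(\<Sum>j<2. (-1) ^ (k * 2 + j) / (2 * real (k * 2 + j) + 1) ^ 3)
      = 1 / (4 * real k + 1) ^ 3 - 1 / (4 * real k + 3) ^ 3" for k
    by (simp add: algebra_simps minus_one_power_iff)
  then show ?thesis
    using grouped by (intro odd_cubes_sums_from_blocks[where m = 2]) auto
qed

lemma sixth_series_grouped:
  "(\<lambda>k. 1 / (6 * real k + 1) ^ 3 - 1 / (6 * real k + 5) ^ 3) sums (pi ^ 3 / (18 * sqrt 3))"
proof -
  have "cos (pi * (1 / 6)) / sin (pi * (1 / 6)) ^ 3 = 12 / sqrt 3"
    by (simp add: sin_30 cos_30 power3_eq_cube field_simps)
  then have "pi ^ 3 / 6 ^ 3 * (cos (pi * (1 / 6)) / sin (pi * (1 / 6)) ^ 3) = pi ^ 3 / (18 * sqrt 3)"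
    by (simp only:) simp
  then show ?thesis
    using sums_opposite_residues[of 1 6] by (simp only:) simp
qed

lemma sixth_series:
  "(\<lambda>n. coeff6 (2 * n + 1) / real (2 * n + 1) ^ 3) sums (pi ^ 3 / (18 * sqrt 3))"
proof -
  have mods: "(6 * k + 1) mod 6 = 1" "(6 * k + 3) mod 6 = 3" "(6 * k + 5) mod 6 = 5" for k :: nat
    by presburger+
  have "{..<3} = {0, 1, 2 :: nat}"
    by auto
  then have "(\<Sum>j<3. coeff6 (2 * (k * 3 + j) + 1) / (2 * real (k * 3 + j) + 1) ^ 3)
      = coeff6 (6 * k + 1) / (6 * real k + 1) ^ 3 + coeff6 (6 * k + 3) / (6 * real k + 3) ^ 3
        + coeff6 (6 * k + 5) / (6 * real k + 5) ^ 3" for k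
    by (simp add: algebra_simps Suc3_eq_add_3)
  then have "(\<Sum>j<3. coeff6 (2 * (k * 3 + j) + 1) / (2 * real (k * 3 + j) + 1) ^ 3)
      = 1 / (6 * real k + 1) ^ 3 - 1 / (6 * real k + 5) ^ 3" for k
    unfolding coeff6_def mods by simp
  then have "(\<lambda>n. coeff6 (2 * n + 1) / (2 * real n + 1) ^ 3) sums (pi ^ 3 / (18 * sqrt 3))"
    using sixth_series_grouped
    by (intro odd_cubes_sums_from_blocks[where m = 3]) (auto simp: coeff6_def)
  then show ?thesis
    by (simp add: add.commute)
qed

lemma eighth_series_grouped:
  "(\<lambda>k. 1 / (8 * real k + 1) ^ 3 + 1 / (8 * real k + 3) ^ 3
          - 1 / (8 * real k + 5) ^ 3 - 1 / (8 * real k + 7) ^ 3) sums (3 * pi ^ 3 / (64 * sqrt 2))"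
proof -
  let ?v = "\<lambda>x. cos (pi * x) / sin (pi * x) ^ 3"
  have "(\<lambda>k. 1 / (8 * real k + 1) ^ 3 - 1 / (8 * real k + (8 - 1)) ^ 3
          + (1 / (8 * real k + 3) ^ 3 - 1 / (8 * real k + (8 - 3)) ^ 3))
      sums (pi ^ 3 / 8 ^ 3 * ?v (1 / 8) + pi ^ 3 / 8 ^ 3 * ?v (3 / 8))"
    by (intro sums_add sums_opposite_residues) auto
  also have "pi ^ 3 / 8 ^ 3 * ?v (1 / 8) + pi ^ 3 / 8 ^ 3 * ?v (3 / 8) = 3 * pi ^ 3 / (64 * sqrt 2)"
    unfolding distrib_left[symmetric] cos_over_sin_cubed_eighths by simp
  finally show ?thesis
    by (simp add: algebra_simps)
qed

lemma eighth_series: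
  "(\<lambda>n. coeff8 (2 * n + 1) / real (2 * n + 1) ^ 3) sums (3 * pi ^ 3 / (64 * sqrt 2))"
proof -
  have mods: "(8 * k + 1) mod 8 = 1" "(8 * k + 3) mod 8 = 3"
    "(8 * k + 5) mod 8 = 5" "(8 * k + 7) mod 8 = 7" for k :: nat
    by presburger+
  have "{..<4} = {0, 1, 2, 3 :: nat}"
    by auto
  then have "(\<Sum>j<4. coeff8 (2 * (k * 4 + j) + 1) / (2 * real (k * 4 + j) + 1) ^ 3)
      = coeff8 (8 * k + 1) / (8 * real k + 1) ^ 3 + coeff8 (8 * k + 3) / (8 * real k + 3) ^ 3
        + coeff8 (8 * k + 5) / (8 * real k + 5) ^ 3 + coeff8 (8 * k + 7) / (8 * real k + 7) ^ 3" for k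
    by (simp add: algebra_simps Suc3_eq_add_3)
  then have "(\<Sum>j<4. coeff8 (2 * (k * 4 + j) + 1) / (2 * real (k * 4 + j) + 1) ^ 3)
      = 1 / (8 * real k + 1) ^ 3 + 1 / (8 * real k + 3) ^ 3
        - 1 / (8 * real k + 5) ^ 3 - 1 / (8 * real k + 7) ^ 3" for k
    unfolding coeff8_def mods by simp
  then have "(\<lambda>n. coeff8 (2 * n + 1) / (2 * real n + 1) ^ 3) sums (3 * pi ^ 3 / (64 * sqrt 2))"
    using eighth_series_grouped
    by (intro odd_cubes_sums_from_blocks[where m = 4]) (auto simp: coeff8_def)
  then show ?thesis
    by (simp add: add.commute)
qed

theorem corollary6:
  shows "(\<lambda>n::nat. (-1) ^ n / (2 * real n + 1) ^ 3) sums (pi ^ 3 / 32) \<and>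
    ((\<lambda>n::nat. coeff6 (2 * n + 1) / real (2 * n + 1) ^ 3) sums (pi ^ 3 / (18 * sqrt 3)) \<and>
     (\<lambda>k::nat. 1 / (6 * real k + 1) ^ 3 - 1 / (6 * real k + 5) ^ 3)
       sums (pi ^ 3 / (18 * sqrt 3))) \<and>
    ((\<lambda>n::nat. coeff8 (2 * n + 1) / real (2 * n + 1) ^ 3) sums (3 * pi ^ 3 / (64 * sqrt 2)) \<and>
     (\<lambda>k::nat. 1 / (8 * real k + 1) ^ 3 + 1 / (8 * real k + 3) ^ 3
                - 1 / (8 * real k + 5) ^ 3 - 1 / (8 * real k + 7) ^ 3)
       sums (3 * pi ^ 3 / (64 * sqrt 2)))"
  using quarter_series sixth_series sixth_series_grouped eighth_series eighth_series_grouped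
  by blast

end
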